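(* Let $(Z_t)_{t\ge 0}$ be a real-valued zero-mean square-integrable Lévy process with $E[Z_t^2]=t$ for all $t\ge 0$. Let $\varepsilon>0$, let $t>0$ be fixed, and suppose that $X$ has the same law as $Z_t$. Then the minimum in $$\inf\bigl\{\,E\bigl(E[X\mid X+Y]^2\bigr):\ Y \text{ a real random variable independent of } X,\ \operatorname{var}(Y)\le\varepsilon\,\bigr\}$$ is achieved when $Y$ (independent of $X$) has the same law as $Z_\varepsilon$.
   Context: The infimum is over the possible laws of the noise $Y$, where $Y$ is independent of $X$ and has finite variance at most $\varepsilon$; the quantity $E\bigl(E[X\mid X+Y]^2\bigr)$ depends only on the laws of $X$ and $Y$. *)

theory Defs
  imports "HOL-Probability.Probability"
begin

text \<open>
  Only times \<open>s \<ge> 0\<close> are meaningful. Path regularity is imposed as stochastic continuity; a process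
  with right-continuous paths and left limits satisfying the other conditions is also covered.
\<close>

locale levy_process = prob_space M
  for M :: "'a measure" +
  fixes Z :: "real \<Rightarrow> 'a \<Rightarrow> real"
  assumes measurable_Z: "\<And>s. 0 \<le> s \<Longrightarrow> Z s \<in> borel_measurable M"
    and starts_at_0: "AE \<omega> in M. Z 0 \<omega> = 0"
    and independent_increments:
      "\<And>(\<tau> :: nat \<Rightarrow> real) n. 0 \<le> \<tau> 0 \<Longrightarrow> (\<And>i. i < n \<Longrightarrow> \<tau> i < \<tau> (Suc i)) \<Longrightarrow>
         indep_vars (\<lambda>_. borel) (\<lambda>i \<omega>. Z (\<tau> (Suc i)) \<omega> - Z (\<tau> i) \<omega>) {..<n}"
    and stationary_increments:
      "\<And>s h. 0 \<le> s \<Longrightarrow> 0 \<le> h \<Longrightarrow>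
         distr M borel (\<lambda>\<omega>. Z (s + h) \<omega> - Z s \<omega>) = distr M borel (Z h)"
    and stochastically_continuous:
      "\<And>s e. 0 \<le> s \<Longrightarrow> 0 < e \<Longrightarrow>
         ((\<lambda>u. prob {\<omega> \<in> space M. e \<le> \<bar>Z u \<omega> - Z s \<omega>\<bar>}) \<longlongrightarrow> 0) (at s within {0..})"

text \<open>\<open>E(E[X | X + Y]\<^sup>2)\<close>, conditioning on the sigma-algebra generated by \<open>X + Y\<close>.\<close>

definition cond_exp_energy :: "'b measure \<Rightarrow> ('b \<Rightarrow> real) \<Rightarrow> ('b \<Rightarrow> real) \<Rightarrow> real" where
  "cond_exp_energy N X Y =
     (\<integral>\<omega>. (real_cond_exp N (vimage_algebra (space N) (\<lambda>\<omega>. X \<omega> + Y \<omega>) borel) X \<omega>)\<^sup>2 \<partial>N)"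

text \<open>
  \<open>Y\<close> need not live on the space on which \<open>X\<close> was originally given, so \<open>X\<close> enters only through
  its law \<open>\<mu>\<close>. Integrability of \<open>Y\<^sup>2\<close> is required because the variance of a \<open>Y\<close> without
  second moment would be \<open>0\<close> by the convention for non-integrable functions. Measurability of
  \<open>X\<close> and \<open>Y\<close> is part of \<open>indep_var\<close>.
\<close>

definition admissible_noise ::
    "real measure \<Rightarrow> real \<Rightarrow> 'b measure \<Rightarrow> ('b \<Rightarrow> real) \<Rightarrow> ('b \<Rightarrow> real) \<Rightarrow> bool" where
  "admissible_noise \<mu> \<epsilon> N X Y \<longleftrightarrow>
     prob_space N \<and> prob_space.indep_var N borel X borel Y \<and> distr N borel X = \<mu> \<and>
     integrable N (\<lambda>\<omega>. (Y \<omega>)\<^sup>2) \<and> prob_space.variance N Y \<le> \<epsilon>"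

text \<open>
  The sample type \<^typ>\<open>real \<times> real\<close> carries every joint law of \<open>(X, Y)\<close> (as the law of the two
  coordinate projections), so fixing it does not restrict the laws over which the infimum is taken.
\<close>

definition energy_values :: "real measure \<Rightarrow> real \<Rightarrow> real set" where
  "energy_values \<mu> \<epsilon> =
     {cond_exp_energy N X Y | (N :: (real \<times> real) measure) X Y. admissible_noise \<mu> \<epsilon> N X Y}"

end

theory Submission
  imports Defs
begin

text \<open>
  Write \<open>S = X + Y\<close>. Projecting \<open>E[X | S]\<close> onto the line spanned by \<open>S - E[S]\<close> can only decrease the
  energy, and that projection is determined by second moments alone: since \<open>E[X (S - E[S])] = t\<close> and
  \<open>var S \<le> t + \<epsilon>\<close>, every admissible noise satisfies \<open>E(E[X | S]\<^sup>2) \<ge> t\<^sup>2 / (t + \<epsilon>)\<close>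
  (\<open>cond_exp_energy_ge_linear\<close>). Equality requires that the conditional expectation be linear in \<open>S\<close>, and
  Levy noise achieves this because \<open>E[Z\<^sub>t | Z\<^sub>T] = (t / T) Z\<^sub>T\<close> for \<open>T = t + \<epsilon>\<close>.

  The linearity comes from exchangeability of increments. Fix a Borel set \<open>A\<close>. The law of the pair
  formed by an increment over an interval inside \<open>[0, T]\<close> and the remaining part of \<open>Z\<^sub>T\<close> depends
  only on the length of the interval (\<open>joint_law_increment_rest\<close>). So \<open>g(s) = E[Z\<^sub>s; Z\<^sub>T \<in> A]\<close> is
  additive in \<open>s\<close>, and it is bounded because the second moments are. A bounded
  additive function on an interval is linear (\<open>bounded_additive_imp_linear\<close>), hence
  \<open>E[Z\<^sub>t; Z\<^sub>T \<in> A] = (t / T) E[Z\<^sub>T; Z\<^sub>T \<in> A]\<close> for all \<open>A\<close>, which characterises the conditional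
  expectation. Both sides depend only on the joint law of \<open>(Z\<^sub>t, Z\<^sub>T - Z\<^sub>t)\<close>, which is that of the
  independent pair \<open>(X, Y)\<close>.
\<close>

section \<open>Bounded additive functions on an interval\<close>

text \<open>
  Subtracting the linear interpolation gives an additive function \<open>e\<close> with \<open>e T = 0\<close>, which
  therefore behaves as if it were \<open>T\<close>-periodic. Every multiple \<open>n * e s\<close> is then a value of \<open>e\<close>,
  taken at \<open>n * s\<close> reduced modulo \<open>T\<close>, and boundedness forces \<open>e s = 0\<close>.
\<close>

lemma bounded_additive_imp_linear:
  fixes d :: "real \<Rightarrow> real"
  assumes add: "\<And>a b. 0 < a \<Longrightarrow> 0 < b \<Longrightarrow> a + b \<le> T \<Longrightarrow> d (a + b) = d a + d b"
    and bound: "\<And>a. 0 < a \<Longrightarrow> a \<le> T \<Longrightarrow> \<bar>d a\<bar> \<le> K"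
    and s: "0 < s" "s \<le> T"
  shows "d s = s / T * d T"
proof -
  define e where "e x = d x - x / T * d T" for x
  have T: "0 < T" using s by simp
  have eT: "e T = 0" using T by (simp add: e_def)
  have e_add: "e (a + b) = e a + e b" if "0 < a" "0 < b" "a + b \<le> T" for a b
    using add[OF that] by (simp add: e_def add_divide_distrib distrib_right)
  have e_bound: "\<bar>e a\<bar> \<le> 2 * K" if "0 < a" "a \<le> T" for a
  proof -
    have "\<bar>a / T * d T\<bar> \<le> 1 * \<bar>d T\<bar>"
      unfolding abs_mult using that T by (intro mult_right_mono) auto
    then show ?thesis
      using bound[OF that] bound[OF T order_refl] unfolding e_def by linarith
  qed
  have multiples: "\<exists>r. 0 < r \<and> r \<le> T \<and> e r = real n * e s" for n
  proof (induction n)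
    case 0
    then show ?case using T eT by auto
  next
    case (Suc n)
    then obtain r where r: "0 < r" "r \<le> T" "e r = real n * e s" by blast
    consider "r + s \<le> T" | "r = T" | "r < T" "r + s > T" using r by linarith
    then show ?case
    proof cases
      case 1
      then show ?thesis
        using r s e_add[of r s] by (intro exI[of _ "r + s"]) (auto simp: distrib_right)
    next
      case 2
      then show ?thesis
        using r s eT by (intro exI[of _ s]) (simp add: distrib_right)
    next
      case 3
      have "e s = e (T - r) + e (r + s - T)"
        using 3 s e_add[of "T - r" "r + s - T"] by simp
      moreover have "e r + e (T - r) = 0"
        using 3 r eT e_add[of r "T - r"] by simp
      ultimately show ?thesis
        using 3 r s by (intro exI[of _ "r + s - T"]) (auto simp: distrib_right)
    qed
  qed
  have "real n * \<bar>e s\<bar> \<le> 2 * K" for n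
    using multiples[of n] e_bound by (metis abs_mult abs_of_nat)
  then have "e s = 0"
    using reals_Archimedean3[of "\<bar>e s\<bar>"] by (meson not_le zero_less_abs_iff)
  then show ?thesis by (simp add: e_def)
qed

section \<open>Exchangeability of increments\<close>

lemma (in prob_space) joint_law_indep_var:
  assumes "indep_var borel X borel Y" "distr M borel X = \<mu>" "distr M borel Y = \<nu>"
  shows "distr M (borel \<Otimes>\<^sub>M borel) (\<lambda>\<omega>. (X \<omega>, Y \<omega>)) = \<mu> \<Otimes>\<^sub>M \<nu>"
  using assms indep_var_distribution_eq[of borel X borel Y] by simp

lemma (in prob_space) law_sum_indep_var:
  fixes X Y :: "'a \<Rightarrow> real"
  assumes "indep_var borel X borel Y" "distr M borel X = \<mu>" "distr M borel Y = \<nu>"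
  shows "distr M borel (\<lambda>\<omega>. X \<omega> + Y \<omega>) = distr (\<mu> \<Otimes>\<^sub>M \<nu>) borel (\<lambda>(x, y). x + y)"
proof -
  note [measurable] = indep_var_rv1[OF assms(1)] indep_var_rv2[OF assms(1)]
  show ?thesis
    unfolding joint_law_indep_var[OF assms, symmetric]
    by (subst distr_distr) (auto simp: comp_def)
qed

text \<open>
  Two pairs on different sample spaces are compared by giving both expectations the same right-hand
  side.
\<close>

lemma integral_eq_of_joint_law:
  fixes X Y :: "'a \<Rightarrow> real" and f :: "real \<Rightarrow> real \<Rightarrow> real"
  assumes law: "distr M (borel \<Otimes>\<^sub>M borel) (\<lambda>\<omega>. (X \<omega>, Y \<omega>)) = \<rho>"
    and [measurable]: "X \<in> borel_measurable M" "Y \<in> borel_measurable M"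
      "(\<lambda>(x, y). f x y) \<in> borel_measurable (borel \<Otimes>\<^sub>M borel)"
  shows "(\<integral>\<omega>. f (X \<omega>) (Y \<omega>) \<partial>M) = (\<integral>p. f (fst p) (snd p) \<partial>\<rho>)"
  unfolding law[symmetric] by (subst integral_distr) (auto simp: case_prod_beta')

context levy_process
begin

lemma indep_increment_rest:
  assumes "0 \<le> \<tau> 0" "\<forall>i<n. \<tau> i < \<tau> (Suc i)" "k < n"
  shows "indep_var borel (\<lambda>\<omega>. Z (\<tau> (Suc k)) \<omega> - Z (\<tau> k) \<omega>)
    borel (\<lambda>\<omega>. Z (\<tau> n) \<omega> - Z (\<tau> 0) \<omega> - (Z (\<tau> (Suc k)) \<omega> - Z (\<tau> k) \<omega>))"
proof -
  have "indep_vars (\<lambda>_. borel) (\<lambda>i \<omega>. Z (\<tau> (Suc i)) \<omega> - Z (\<tau> i) \<omega>) (insert k ({..<n} - {k}))"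
    using independent_increments[of \<tau> n] assms by (simp add: insert_absorb)
  from indep_vars_sum[OF _ _ this]
  have "indep_var borel (\<lambda>\<omega>. Z (\<tau> (Suc k)) \<omega> - Z (\<tau> k) \<omega>)
    borel (\<lambda>\<omega>. \<Sum>i\<in>{..<n} - {k}. Z (\<tau> (Suc i)) \<omega> - Z (\<tau> i) \<omega>)"
    by simp
  moreover have "(\<Sum>i\<in>{..<n} - {k}. Z (\<tau> (Suc i)) \<omega> - Z (\<tau> i) \<omega>) =
      Z (\<tau> n) \<omega> - Z (\<tau> 0) \<omega> - (Z (\<tau> (Suc k)) \<omega> - Z (\<tau> k) \<omega>)" for \<omega>
    using assms(3) sum_lessThan_telescope[of "\<lambda>i. Z (\<tau> i) \<omega>" n]
    by (simp add: sum_diff1)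
  ultimately show ?thesis by simp
qed

lemma law_increment:
  assumes "0 \<le> s" "s \<le> u"
  shows "distr M borel (\<lambda>\<omega>. Z u \<omega> - Z s \<omega>) = distr M borel (Z (u - s))"
  using stationary_increments[of s "u - s"] assms by simp

lemma indep_adjacent_increments:
  assumes "0 \<le> a" "a < b" "b < c"
  shows "indep_var borel (\<lambda>\<omega>. Z b \<omega> - Z a \<omega>) borel (\<lambda>\<omega>. Z c \<omega> - Z b \<omega>)"
  using indep_increment_rest[of "\<lambda>i. [a, b, c] ! i" 2 0] assms
  by (simp add: All_less_Suc numeral_2_eq_2)

lemma indep_outer_increments:
  assumes "0 \<le> a" "a < b" "b < c" "c < e"
  shows "indep_var borel (\<lambda>\<omega>. Z b \<omega> - Z a \<omega>) borel (\<lambda>\<omega>. Z e \<omega> - Z c \<omega>)"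
proof -
  define \<tau> where "\<tau> i = [a, b, c, e] ! i" for i
  have "indep_vars (\<lambda>_. borel) (\<lambda>i \<omega>. Z (\<tau> (Suc i)) \<omega> - Z (\<tau> i) \<omega>) {..<3}"
    by (rule independent_increments) (use assms in \<open>auto simp: \<tau>_def less_Suc_eq numeral_3_eq_3\<close>)
  then have "indep_vars (\<lambda>_. borel) (\<lambda>i \<omega>. Z (\<tau> (Suc i)) \<omega> - Z (\<tau> i) \<omega>) (insert 0 {2})"
    by (rule indep_vars_subset) auto
  from indep_vars_sum[OF _ _ this] show ?thesis
    by (simp add: \<tau>_def numeral_2_eq_2 numeral_3_eq_3)
qed

text \<open>
  Removing an increment of length \<open>h\<close> leaves two independent pieces of lengths \<open>s\<close> and
  \<open>T - (s + h)\<close>; pushing them together gives the same law as one increment of length \<open>T - h\<close>.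
\<close>

lemma law_rest:
  assumes "0 \<le> s" "0 < h" "s + h \<le> T"
  shows "distr M borel (\<lambda>\<omega>. Z T \<omega> - Z 0 \<omega> - (Z (s + h) \<omega> - Z s \<omega>)) = distr M borel (Z (T - h))"
proof -
  consider "s = 0" | "s + h = T" | "0 < s" "s + h < T" using assms by linarith
  then show ?thesis
  proof cases
    case 1
    then show ?thesis using law_increment[of h T] assms by simp
  next
    case 2
    then have "T - h = s" by simp
    show ?thesis unfolding \<open>T - h = s\<close> using law_increment[of 0 s] assms 2 by simp
  next
    case 3
    have "distr M borel (\<lambda>\<omega>. (Z s \<omega> - Z 0 \<omega>) + (Z T \<omega> - Z (s + h) \<omega>)) =
        distr M borel (\<lambda>\<omega>. (Z s \<omega> - Z 0 \<omega>) + (Z (T - h) \<omega> - Z s \<omega>))"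
      using 3 assms law_increment[of 0 s] law_increment[of "s + h" T] law_increment[of s "T - h"]
      by (subst (1 2) law_sum_indep_var[where \<mu>="distr M borel (Z s)" and \<nu>="distr M borel (Z (T - (s + h)))"])
        (auto intro!: indep_outer_increments indep_adjacent_increments simp: algebra_simps)
    then show ?thesis using law_increment[of 0 "T - h"] assms 3 by (simp add: algebra_simps)
  qed
qed

text \<open>
  Exchangeability in the form used below: the position \<open>s\<close> of the interval does not enter the joint
  law. An interval touching an endpoint of \<open>[0, T]\<close> leaves only one further increment, because
  \<open>independent_increments\<close> concerns strictly increasing times.
\<close>

lemma joint_law_increment_rest:
  assumes "0 \<le> s" "0 < h" "s + h \<le> T" "h < T"
  shows "distr M (borel \<Otimes>\<^sub>M borel)
      (\<lambda>\<omega>. (Z (s + h) \<omega> - Z s \<omega>, Z T \<omega> - Z 0 \<omega> - (Z (s + h) \<omega> - Z s \<omega>))) =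
    distr M borel (Z h) \<Otimes>\<^sub>M distr M borel (Z (T - h))"
proof (rule joint_law_indep_var[OF _ _ law_rest])
  consider "s = 0" | "0 < s" "s + h = T" | "0 < s" "s + h < T" using assms by linarith
  then show "indep_var borel (\<lambda>\<omega>. Z (s + h) \<omega> - Z s \<omega>)
      borel (\<lambda>\<omega>. Z T \<omega> - Z 0 \<omega> - (Z (s + h) \<omega> - Z s \<omega>))"
  proof cases
    case 1
    then show ?thesis
      using indep_increment_rest[of "\<lambda>i. [0, h, T] ! i" 2 0] assms
      by (simp add: All_less_Suc numeral_2_eq_2)
  next
    case 2
    then show ?thesis
      using indep_increment_rest[of "\<lambda>i. [0, s, T] ! i" 2 1] assms
      by (simp add: All_less_Suc numeral_2_eq_2)
  next
    case 3
    then show ?thesis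
      using indep_increment_rest[of "\<lambda>i. [0, s, s + h, T] ! i" 3 1] assms
      by (simp add: All_less_Suc numeral_3_eq_3)
  qed
qed (use assms law_increment[of s "s + h"] in auto)

end

section \<open>Linearity of the conditional expectation\<close>

locale standard_levy_process = levy_process +
  assumes square_int: "\<And>s. 0 \<le> s \<Longrightarrow> integrable M (\<lambda>\<omega>. (Z s \<omega>)\<^sup>2)"
    and mean: "\<And>s. 0 \<le> s \<Longrightarrow> (\<integral>\<omega>. Z s \<omega> \<partial>M) = 0"
    and second_moment: "\<And>s. 0 \<le> s \<Longrightarrow> (\<integral>\<omega>. (Z s \<omega>)\<^sup>2 \<partial>M) = s"
begin

text \<open>
  As a function of \<open>t\<close> the left-hand side is additive: splitting \<open>[0, a + b]\<close> at \<open>a\<close>, the increment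
  over the second part may be moved back to start at \<open>0\<close> by exchangeability. It is bounded on \<open>[0, T]\<close>
  by the second moments, hence linear. The increments from time \<open>0\<close> are used in place of \<open>Z\<close> itself, since \<open>Z 0 = 0\<close> holds only almost
  surely while the independence statements concern increments.
\<close>

lemma partial_expectation_linear:
  assumes A[measurable]: "A \<in> sets borel" and t: "0 < t" "t \<le> T"
  shows "(\<integral>\<omega>. (Z t \<omega> - Z 0 \<omega>) * indicator A (Z T \<omega> - Z 0 \<omega>) \<partial>M) =
    t / T * (\<integral>\<omega>. (Z T \<omega> - Z 0 \<omega>) * indicator A (Z T \<omega> - Z 0 \<omega>) \<partial>M)"
proof (rule bounded_additive_imp_linear[OF _ _ t])
  have Z_int: "integrable M (Z s)" if "0 \<le> s" for s
    using square_integrable_imp_integrable[OF measurable_Z[OF that] square_int[OF that]] .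
  have part_int: "integrable M (\<lambda>\<omega>. (Z u \<omega> - Z s \<omega>) * indicator A (Z T \<omega> - Z 0 \<omega>))"
    if "0 \<le> s" "0 \<le> u" for s u
  proof -
    have [measurable]: "Z s \<in> borel_measurable M" "Z u \<in> borel_measurable M"
      "Z 0 \<in> borel_measurable M" "Z T \<in> borel_measurable M"
      using that t by (auto intro!: measurable_Z)
    show ?thesis
      by (rule Bochner_Integration.integrable_bound[where f = "\<lambda>\<omega>. Z u \<omega> - Z s \<omega>"])
        (use that t in \<open>auto intro!: Z_int simp: indicator_def\<close>)
  qed
  {
    fix a b :: real assume ab: "0 < a" "0 < b" "a + b \<le> T"
    have [measurable]: "Z a \<in> borel_measurable M" "Z b \<in> borel_measurable M" "Z 0 \<in> borel_measurable M"
      "Z T \<in> borel_measurable M" "Z (a + b) \<in> borel_measurable M"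
      using ab by (auto intro!: measurable_Z)
    let ?f = "\<lambda>x y :: real. x * indicator A (x + y) :: real"
    have shift: "(\<integral>\<omega>. ?f (Z (a + b) \<omega> - Z a \<omega>) (Z T \<omega> - Z 0 \<omega> - (Z (a + b) \<omega> - Z a \<omega>)) \<partial>M) =
        (\<integral>\<omega>. ?f (Z (0 + b) \<omega> - Z 0 \<omega>) (Z T \<omega> - Z 0 \<omega> - (Z (0 + b) \<omega> - Z 0 \<omega>)) \<partial>M)"
      by (subst (1 2) integral_eq_of_joint_law[OF joint_law_increment_rest, where f = ?f])
        (use ab in auto)
    have "(\<integral>\<omega>. (Z (a + b) \<omega> - Z 0 \<omega>) * indicator A (Z T \<omega> - Z 0 \<omega>) \<partial>M) =
      (\<integral>\<omega>. (Z a \<omega> - Z 0 \<omega>) * indicator A (Z T \<omega> - Z 0 \<omega>)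
        + (Z (a + b) \<omega> - Z a \<omega>) * indicator A (Z T \<omega> - Z 0 \<omega>) \<partial>M)"
      by (simp flip: distrib_right)
    also have "\<dots> = (\<integral>\<omega>. (Z a \<omega> - Z 0 \<omega>) * indicator A (Z T \<omega> - Z 0 \<omega>) \<partial>M)
      + (\<integral>\<omega>. (Z (a + b) \<omega> - Z a \<omega>) * indicator A (Z T \<omega> - Z 0 \<omega>) \<partial>M)"
      using ab by (intro Bochner_Integration.integral_add part_int) auto
    also have "\<dots> = (\<integral>\<omega>. (Z a \<omega> - Z 0 \<omega>) * indicator A (Z T \<omega> - Z 0 \<omega>) \<partial>M)
      + (\<integral>\<omega>. (Z b \<omega> - Z 0 \<omega>) * indicator A (Z T \<omega> - Z 0 \<omega>) \<partial>M)"
      using shift by simp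
    finally show "(\<integral>\<omega>. (Z (a + b) \<omega> - Z 0 \<omega>) * indicator A (Z T \<omega> - Z 0 \<omega>) \<partial>M) =
      (\<integral>\<omega>. (Z a \<omega> - Z 0 \<omega>) * indicator A (Z T \<omega> - Z 0 \<omega>) \<partial>M)
      + (\<integral>\<omega>. (Z b \<omega> - Z 0 \<omega>) * indicator A (Z T \<omega> - Z 0 \<omega>) \<partial>M)" .
  next
    fix a assume a: "0 < a" "a \<le> T"
    have abs_le: "\<bar>x\<bar> \<le> x\<^sup>2 + 1" for x :: real
    proof -
      have "0 \<le> (\<bar>x\<bar> - 1)\<^sup>2 + x\<^sup>2 + 1" by simp
      then show ?thesis by (simp add: power2_diff)
    qed
    have lhs_int: "integrable M (\<lambda>\<omega>. (Z a \<omega> - Z 0 \<omega>) * indicator A (Z T \<omega> - Z 0 \<omega>))"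
      using a by (intro part_int) auto
    have rhs_int: "integrable M (\<lambda>\<omega>. ((Z a \<omega>)\<^sup>2 + 1) + ((Z 0 \<omega>)\<^sup>2 + 1))"
      using a square_int[of a] square_int[of 0] by simp
    have "norm (\<integral>\<omega>. (Z a \<omega> - Z 0 \<omega>) * indicator A (Z T \<omega> - Z 0 \<omega>) \<partial>M) \<le>
      (\<integral>\<omega>. ((Z a \<omega>)\<^sup>2 + 1) + ((Z 0 \<omega>)\<^sup>2 + 1) \<partial>M)"
    proof (rule order_trans[OF integral_norm_bound integral_mono[OF integrable_norm[OF lhs_int] rhs_int]])
      fix \<omega>
      show "norm ((Z a \<omega> - Z 0 \<omega>) * indicator A (Z T \<omega> - Z 0 \<omega>)) \<le> ((Z a \<omega>)\<^sup>2 + 1) + ((Z 0 \<omega>)\<^sup>2 + 1)"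
        using abs_le[of "Z a \<omega>"] abs_le[of "Z 0 \<omega>"] by (auto simp: indicator_def)
    qed
    also have "\<dots> = a + 2"
      using a square_int[of a] square_int[of 0] second_moment[of a] second_moment[of 0]
      by (simp add: prob_space)
    finally show "\<bar>\<integral>\<omega>. (Z a \<omega> - Z 0 \<omega>) * indicator A (Z T \<omega> - Z 0 \<omega>) \<partial>M\<bar> \<le> T + 2"
      using a by simp
  }
qed

text \<open>
  The laws of \<open>X\<close> and \<open>Y\<close> are those of consecutive increments of lengths \<open>t\<close> and \<open>\<epsilon>\<close>, so the
  identity transfers to \<open>(X, Y)\<close> through the joint law.
\<close>

lemma indep_copy_partial_expectation:
  fixes X Y :: "'b \<Rightarrow> real"
  assumes A[measurable]: "A \<in> sets borel" and t: "0 < t" "0 < \<epsilon>"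
    and N: "prob_space N" and indep: "prob_space.indep_var N borel X borel Y"
    and laws: "distr N borel X = distr M borel (Z t)" "distr N borel Y = distr M borel (Z \<epsilon>)"
  shows "(\<integral>\<omega>. X \<omega> * indicator A (X \<omega> + Y \<omega>) \<partial>N) =
    t / (t + \<epsilon>) * (\<integral>\<omega>. (X \<omega> + Y \<omega>) * indicator A (X \<omega> + Y \<omega>) \<partial>N)"
proof -
  interpret N: prob_space N by fact
  note [measurable] = N.indep_var_rv1[OF indep] N.indep_var_rv2[OF indep]
  have [measurable]: "Z 0 \<in> borel_measurable M" "Z t \<in> borel_measurable M" "Z (t + \<epsilon>) \<in> borel_measurable M"
    using t by (auto intro!: measurable_Z)
  have law: "distr N (borel \<Otimes>\<^sub>M borel) (\<lambda>\<omega>. (X \<omega>, Y \<omega>)) =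
      distr M (borel \<Otimes>\<^sub>M borel) (\<lambda>\<omega>. (Z t \<omega> - Z 0 \<omega>, Z (t + \<epsilon>) \<omega> - Z 0 \<omega> - (Z t \<omega> - Z 0 \<omega>)))"
    using N.joint_law_indep_var[OF indep laws] joint_law_increment_rest[of 0 t "t + \<epsilon>"] t by simp
  have transfer: "(\<integral>\<omega>. f (X \<omega>) (Y \<omega>) \<partial>N) =
      (\<integral>\<omega>. f (Z t \<omega> - Z 0 \<omega>) (Z (t + \<epsilon>) \<omega> - Z 0 \<omega> - (Z t \<omega> - Z 0 \<omega>)) \<partial>M)"
    if [measurable]: "(\<lambda>(x, y). f x y) \<in> borel_measurable (borel \<Otimes>\<^sub>M borel)" for f :: "real \<Rightarrow> real \<Rightarrow> real"
    using integral_eq_of_joint_law[OF law, of f] integral_eq_of_joint_law[OF refl, of _ M _ f] by simp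
  show ?thesis
    using transfer[of "\<lambda>x y. x * indicator A (x + y)"]
      transfer[of "\<lambda>x y. (x + y) * indicator A (x + y)"]
      partial_expectation_linear[OF A, of t "t + \<epsilon>"] t
    by simp
qed

end

section \<open>The energy of the conditional expectation\<close>

lemma subalgebra_vimage_algebra:
  assumes "S \<in> borel_measurable N"
  shows "subalgebra N (vimage_algebra (space N) S borel)"
  using assms unfolding subalgebra_def
  by (auto simp: sets_vimage_algebra2 intro: measurable_sets)

text \<open>
  Expanding \<open>0 \<le> E(E[X | S] - a S')\<^sup>2\<close> for \<open>S' = S - E[S]\<close>; the coefficient \<open>a = t / (t + \<epsilon>)\<close> is that of
  the best linear predictor when the variance bound is attained.
\<close>

lemma cond_exp_energy_ge_linear:
  fixes X Y :: "'b \<Rightarrow> real"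
  assumes N: "prob_space N" and indep: "prob_space.indep_var N borel X borel Y"
    and X2: "integrable N (\<lambda>\<omega>. (X \<omega>)\<^sup>2)" and EX: "(\<integral>\<omega>. X \<omega> \<partial>N) = 0"
    and EX2: "(\<integral>\<omega>. (X \<omega>)\<^sup>2 \<partial>N) = t"
    and Y2: "integrable N (\<lambda>\<omega>. (Y \<omega>)\<^sup>2)" and varY: "prob_space.variance N Y \<le> \<epsilon>"
    and pos: "0 < t" "0 < \<epsilon>"
  shows "t\<^sup>2 / (t + \<epsilon>) \<le> cond_exp_energy N X Y"
proof -
  interpret prob_space N by fact
  note [measurable] = indep_var_rv1[OF indep] indep_var_rv2[OF indep]
  define F where "F = vimage_algebra (space N) (\<lambda>\<omega>. X \<omega> + Y \<omega>) borel"
  have sub: "subalgebra N F"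
    unfolding F_def by (rule subalgebra_vimage_algebra) simp
  interpret finite_measure_subalgebra N F
    by standard (rule sub)
  define C where "C = real_cond_exp N F X"
  define m where "m = expectation Y"
  define D where "D \<omega> = X \<omega> + Y \<omega> - m" for \<omega>
  define a where "a = t / (t + \<epsilon>)"
  have X1: "integrable N X" and Y1: "integrable N Y"
    using X2 Y2 by (auto intro: square_integrable_imp_integrable)
  have "(\<lambda>\<omega>. X \<omega> + Y \<omega>) \<in> borel_measurable F"
    unfolding F_def by (rule measurable_vimage_algebra1) auto
  then have DF: "D \<in> borel_measurable F" unfolding D_def by simp
  have [measurable]: "D \<in> borel_measurable N" unfolding D_def by simp
  have CN[measurable]: "C \<in> borel_measurable N" unfolding C_def by simp
  have C2: "integrable N (\<lambda>\<omega>. (C \<omega>)\<^sup>2)"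
    unfolding C_def
    by (rule integrable_convex_cond_exp[where I = UNIV and q = "\<lambda>x. x\<^sup>2"])
      (use X1 X2 in \<open>auto intro: convex_power2\<close>)
  have XY: "integrable N (\<lambda>\<omega>. X \<omega> * Y \<omega>)" "(\<integral>\<omega>. X \<omega> * Y \<omega> \<partial>N) = 0"
    using indep_var_integrable[OF indep X1 Y1] indep_var_lebesgue_integral[OF indep X1 Y1] EX by auto
  have Ym2: "integrable N (\<lambda>\<omega>. (Y \<omega> - m)\<^sup>2)"
    using Y1 Y2 by (simp add: power2_diff)
  have XD_eq: "D \<omega> * X \<omega> = (X \<omega>)\<^sup>2 + X \<omega> * Y \<omega> - m * X \<omega>" for \<omega>
    by (simp add: D_def power2_eq_square algebra_simps)
  have XD: "integrable N (\<lambda>\<omega>. D \<omega> * X \<omega>)" "(\<integral>\<omega>. D \<omega> * X \<omega> \<partial>N) = t"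
    unfolding XD_eq using X1 X2 XY EX EX2 by auto
  have D2_eq: "(D \<omega>)\<^sup>2 = (X \<omega>)\<^sup>2 + (Y \<omega> - m)\<^sup>2 + 2 * (X \<omega> * Y \<omega>) - 2 * m * X \<omega>" for \<omega>
    by (simp add: D_def power2_eq_square algebra_simps)
  have D2: "integrable N (\<lambda>\<omega>. (D \<omega>)\<^sup>2)" "(\<integral>\<omega>. (D \<omega>)\<^sup>2 \<partial>N) = t + variance Y"
    unfolding D2_eq using X1 X2 XY Ym2 EX EX2 by (auto simp: m_def)
  have DC: "integrable N (\<lambda>\<omega>. D \<omega> * C \<omega>)" "(\<integral>\<omega>. D \<omega> * C \<omega> \<partial>N) = t"
    using real_cond_exp_intg[OF XD(1) DF] XD(2) unfolding C_def by auto
  have "0 \<le> (\<integral>\<omega>. (C \<omega> - a * D \<omega>)\<^sup>2 \<partial>N)" by simp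
  also have "\<dots> = (\<integral>\<omega>. (C \<omega>)\<^sup>2 - 2 * a * (D \<omega> * C \<omega>) + a\<^sup>2 * (D \<omega>)\<^sup>2 \<partial>N)"
    by (rule Bochner_Integration.integral_cong) (auto simp: power2_eq_square algebra_simps)
  also have "\<dots> = (\<integral>\<omega>. (C \<omega>)\<^sup>2 \<partial>N) - 2 * a * t + a\<^sup>2 * (t + variance Y)"
    using C2 D2 DC by simp
  also have "\<dots> \<le> (\<integral>\<omega>. (C \<omega>)\<^sup>2 \<partial>N) - 2 * a * t + a\<^sup>2 * (t + \<epsilon>)"
    using varY by (intro add_left_mono mult_left_mono) auto
  also have "\<dots> = (\<integral>\<omega>. (C \<omega>)\<^sup>2 \<partial>N) - t\<^sup>2 / (t + \<epsilon>)"
    using pos by (simp add: a_def power2_eq_square divide_simps)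
  finally show ?thesis by (simp add: cond_exp_energy_def C_def F_def)
qed

text \<open>
  Every event of the conditioning sigma-algebra has the form \<open>X + Y \<in> A\<close>, so the hypothesis
  identifies \<open>a * (X + Y)\<close> as the conditional expectation.
\<close>

lemma cond_exp_energy_linear:
  fixes X Y :: "'b \<Rightarrow> real"
  assumes N: "prob_space N"
    and X: "integrable N X" and Y: "integrable N Y"
    and lin: "\<And>A. A \<in> sets borel \<Longrightarrow> (\<integral>\<omega>. X \<omega> * indicator A (X \<omega> + Y \<omega>) \<partial>N) =
      a * (\<integral>\<omega>. (X \<omega> + Y \<omega>) * indicator A (X \<omega> + Y \<omega>) \<partial>N)"
  shows "cond_exp_energy N X Y = a\<^sup>2 * (\<integral>\<omega>. (X \<omega> + Y \<omega>)\<^sup>2 \<partial>N)"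
proof -
  interpret prob_space N by fact
  note [measurable] = borel_measurable_integrable[OF X] borel_measurable_integrable[OF Y]
  define F where "F = vimage_algebra (space N) (\<lambda>\<omega>. X \<omega> + Y \<omega>) borel"
  have sub: "subalgebra N F"
    unfolding F_def by (rule subalgebra_vimage_algebra) simp
  interpret finite_measure_subalgebra N F
    by standard (rule sub)
  have SF: "(\<lambda>\<omega>. X \<omega> + Y \<omega>) \<in> borel_measurable F"
    unfolding F_def by (rule measurable_vimage_algebra1) auto
  have "AE \<omega> in N. real_cond_exp N F X \<omega> = a * (X \<omega> + Y \<omega>)"
  proof (rule real_cond_exp_charact)
    fix B assume "B \<in> sets F"
    then obtain A where A: "A \<in> sets borel" and B: "B = (\<lambda>\<omega>. X \<omega> + Y \<omega>) -` A \<inter> space N"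
      unfolding F_def by (auto simp: sets_vimage_algebra2)
    have on_B: "(\<integral>\<omega>\<in>B. f \<omega> \<partial>N) = (\<integral>\<omega>. f \<omega> * indicator A (X \<omega> + Y \<omega>) \<partial>N)" for f :: "'b \<Rightarrow> real"
      unfolding set_lebesgue_integral_def
      by (rule Bochner_Integration.integral_cong) (auto simp: B indicator_def)
    show "(\<integral>\<omega>\<in>B. X \<omega> \<partial>N) = (\<integral>\<omega>\<in>B. a * (X \<omega> + Y \<omega>) \<partial>N)"
      unfolding on_B lin[OF A] by (simp only: mult.assoc integral_mult_right_zero)
  qed (use X Y SF in auto)
  then have "cond_exp_energy N X Y = (\<integral>\<omega>. (a * (X \<omega> + Y \<omega>))\<^sup>2 \<partial>N)"
    unfolding cond_exp_energy_def F_def[symmetric] by (intro integral_cong_AE) auto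
  then show ?thesis by (simp add: power_mult_distrib)
qed

lemma (in standard_levy_process) moments_of_copy:
  fixes V :: "'b \<Rightarrow> real"
  assumes V: "V \<in> borel_measurable N" and law: "distr N borel V = distr M borel (Z s)" and s: "0 \<le> s"
  shows "integrable N (\<lambda>\<omega>. (V \<omega>)\<^sup>2)" "(\<integral>\<omega>. V \<omega> \<partial>N) = 0" "(\<integral>\<omega>. (V \<omega>)\<^sup>2 \<partial>N) = s"
proof -
  note Zs = measurable_Z[OF s]
  show "integrable N (\<lambda>\<omega>. (V \<omega>)\<^sup>2)"
    using integrable_distr_eq[OF V, of "\<lambda>x. x\<^sup>2"] integrable_distr_eq[OF Zs, of "\<lambda>x. x\<^sup>2"]
      law square_int[OF s] by simp
  show "(\<integral>\<omega>. V \<omega> \<partial>N) = 0"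
    using integral_distr[OF V, of "\<lambda>x. x"] integral_distr[OF Zs, of "\<lambda>x. x"] law mean[OF s] by simp
  show "(\<integral>\<omega>. (V \<omega>)\<^sup>2 \<partial>N) = s"
    using integral_distr[OF V, of "\<lambda>x. x\<^sup>2"] integral_distr[OF Zs, of "\<lambda>x. x\<^sup>2"]
      law second_moment[OF s] by simp
qed

text \<open>
  Here \<open>E[X | S] = t / (t + \<epsilon>) * S\<close> and \<open>E[S\<^sup>2] = t + \<epsilon>\<close>. The sample space is arbitrary because the
  result is applied both to the given pair and to the product of the two laws on the plane, where the
  infimum is taken.
\<close>

lemma (in standard_levy_process) cond_exp_energy_levy:
  fixes X Y :: "'b \<Rightarrow> real"
  assumes pos: "0 < t" "0 < \<epsilon>"
    and N: "prob_space N" and indep: "prob_space.indep_var N borel X borel Y"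
    and laws: "distr N borel X = distr M borel (Z t)" "distr N borel Y = distr M borel (Z \<epsilon>)"
  shows "admissible_noise (distr M borel (Z t)) \<epsilon> N X Y" "cond_exp_energy N X Y = t\<^sup>2 / (t + \<epsilon>)"
proof -
  interpret N: prob_space N by fact
  note [measurable] = N.indep_var_rv1[OF indep] N.indep_var_rv2[OF indep]
  have X: "integrable N (\<lambda>\<omega>. (X \<omega>)\<^sup>2)" "(\<integral>\<omega>. X \<omega> \<partial>N) = 0" "(\<integral>\<omega>. (X \<omega>)\<^sup>2 \<partial>N) = t"
    and Y: "integrable N (\<lambda>\<omega>. (Y \<omega>)\<^sup>2)" "(\<integral>\<omega>. Y \<omega> \<partial>N) = 0" "(\<integral>\<omega>. (Y \<omega>)\<^sup>2 \<partial>N) = \<epsilon>"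
    using moments_of_copy[OF _ laws(1)]
      moments_of_copy[OF _ laws(2)] pos by auto
  have X1: "integrable N X" and Y1: "integrable N Y"
    using X(1) Y(1) by (auto intro: N.square_integrable_imp_integrable)
  show "admissible_noise (distr M borel (Z t)) \<epsilon> N X Y"
    unfolding admissible_noise_def using N indep laws Y by simp
  have XY: "integrable N (\<lambda>\<omega>. X \<omega> * Y \<omega>)" "(\<integral>\<omega>. X \<omega> * Y \<omega> \<partial>N) = 0"
    using N.indep_var_integrable[OF indep X1 Y1] N.indep_var_lebesgue_integral[OF indep X1 Y1] X by auto
  have "(\<integral>\<omega>. (X \<omega> + Y \<omega>)\<^sup>2 \<partial>N) = (\<integral>\<omega>. (X \<omega>)\<^sup>2 + (Y \<omega>)\<^sup>2 + 2 * (X \<omega> * Y \<omega>) \<partial>N)"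
    by (simp add: power2_sum mult.assoc)
  also have "\<dots> = t + \<epsilon>" using X Y XY by simp
  finally have S2: "(\<integral>\<omega>. (X \<omega> + Y \<omega>)\<^sup>2 \<partial>N) = t + \<epsilon>" .
  have "cond_exp_energy N X Y = (t / (t + \<epsilon>))\<^sup>2 * (\<integral>\<omega>. (X \<omega> + Y \<omega>)\<^sup>2 \<partial>N)"
    using indep_copy_partial_expectation[OF _ pos N indep laws]
    by (intro cond_exp_energy_linear N X1 Y1) auto
  then show "cond_exp_energy N X Y = t\<^sup>2 / (t + \<epsilon>)"
    unfolding S2 using pos by (simp add: power2_eq_square)
qed

theorem proposition1:
  fixes M :: "'a measure" and Z :: "real \<Rightarrow> 'a \<Rightarrow> real"
    and N :: "'b measure" and X Y :: "'b \<Rightarrow> real"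
    and \<epsilon> t :: real
  assumes "levy_process M Z"
    and "\<And>s. 0 \<le> s \<Longrightarrow> integrable M (\<lambda>\<omega>. (Z s \<omega>)\<^sup>2)"
    and "\<And>s. 0 \<le> s \<Longrightarrow> (\<integral>\<omega>. Z s \<omega> \<partial>M) = 0"
    and "\<And>s. 0 \<le> s \<Longrightarrow> (\<integral>\<omega>. (Z s \<omega>)\<^sup>2 \<partial>M) = s"
    and "0 < \<epsilon>" and "0 < t"
    and "prob_space N"
    and "prob_space.indep_var N borel X borel Y"
    and "distr N borel X = distr M borel (Z t)"
    and "distr N borel Y = distr M borel (Z \<epsilon>)"
  shows "admissible_noise (distr N borel X) \<epsilon> N X Y
    \<and> cond_exp_energy N X Y \<in> energy_values (distr N borel X) \<epsilon>
    \<and> cond_exp_energy N X Y = Inf (energy_values (distr N borel X) \<epsilon>)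
    \<and> (\<forall>Y'. admissible_noise (distr N borel X) \<epsilon> N X Y' \<longrightarrow>
          cond_exp_energy N X Y \<le> cond_exp_energy N X Y')"
proof -
  interpret standard_levy_process M Z
    using assms(1-4) by (intro standard_levy_process.intro standard_levy_process_axioms.intro)
  let ?\<mu> = "distr M borel (Z t)" and ?\<nu> = "distr M borel (Z \<epsilon>)"
  note levy = cond_exp_energy_levy[OF assms(6,5)]
  note here = levy[OF assms(7-10)]

  have [measurable]: "Z t \<in> borel_measurable M" "Z \<epsilon> \<in> borel_measurable M"
    using assms(5,6) by (auto intro!: measurable_Z)
  have lower: "t\<^sup>2 / (t + \<epsilon>) \<le> cond_exp_energy N' X' Y'"
    if adm: "admissible_noise ?\<mu> \<epsilon> N' X' Y'" for N' :: "'c measure" and X' Y'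
  proof -
    have N': "prob_space N'" and indep': "prob_space.indep_var N' borel X' borel Y'"
      and law': "distr N' borel X' = ?\<mu>"
      using adm unfolding admissible_noise_def by auto
    have X': "X' \<in> borel_measurable N'"
      using prob_space.indep_var_rv1[OF N' indep'] .
    show ?thesis
    proof (rule cond_exp_energy_ge_linear[OF N' indep' moments_of_copy[OF X' law']])
      show "integrable N' (\<lambda>\<omega>. (Y' \<omega>)\<^sup>2)" "prob_space.variance N' Y' \<le> \<epsilon>"
        using adm unfolding admissible_noise_def by auto
    qed (use assms(5,6) in simp_all)
  qed

  \<comment> \<open>The energy values come from sample spaces over the plane, so the minimum is
    realised there by the coordinate projections under the product of the two laws.\<close>
  have attained: "t\<^sup>2 / (t + \<epsilon>) \<in> energy_values ?\<mu> \<epsilon>"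
  proof -
    interpret \<mu>: prob_space ?\<mu> by (rule prob_space_distr) simp
    interpret \<nu>: prob_space ?\<nu> by (rule prob_space_distr) simp
    interpret P: pair_prob_space ?\<mu> ?\<nu> ..
    let ?P = "?\<mu> \<Otimes>\<^sub>M ?\<nu>"
    have proj_meas: "fst \<in> borel_measurable ?P" "snd \<in> borel_measurable ?P" by measurable
    have fst_law: "distr ?P borel fst = ?\<mu>"
    proof -
      have "distr ?P borel fst = distr ?P ?\<mu> fst"
        by (rule distr_cong) simp_all
      then show ?thesis by (simp only: \<nu>.distr_pair_fst)
    qed
    have snd_law: "distr ?P borel snd = ?\<nu>"
    proof (rule measure_eqI)
      fix B assume "B \<in> sets (distr ?P borel snd)"
      then have B: "B \<in> sets borel" by simp
      have "snd -` B \<inter> space ?P = space ?\<mu> \<times> B"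
        by (auto simp: space_pair_measure)
      then have "emeasure (distr ?P borel snd) B = emeasure ?P (space ?\<mu> \<times> B)"
        using B by (simp add: emeasure_distr[OF proj_meas(2)])
      also have "\<dots> = emeasure ?\<mu> (space ?\<mu>) * emeasure ?\<nu> B"
        using B by (intro \<nu>.emeasure_pair_measure_Times sets.top) simp
      also have "\<dots> = emeasure ?\<nu> B"
        unfolding \<mu>.emeasure_space_1 by simp
      finally show "emeasure (distr ?P borel snd) B = emeasure ?\<nu> B" .
    qed simp
    have "distr ?P (borel \<Otimes>\<^sub>M borel) (\<lambda>p. (fst p, snd p)) = ?P"
      unfolding prod.collapse by (intro distr_id2 sets_pair_measure_cong) simp_all
    then have "P.indep_var borel fst borel snd"
      unfolding P.indep_var_distribution_eq fst_law snd_law by (intro conjI proj_meas) (rule sym)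
    note product = levy[OF P.prob_space_axioms this fst_law snd_law]
    have "cond_exp_energy ?P fst snd \<in> energy_values ?\<mu> \<epsilon>"
      unfolding energy_values_def by (intro CollectI exI conjI) (rule refl, rule product(1))
    then show ?thesis by (simp only: product(2))
  qed

  have "t\<^sup>2 / (t + \<epsilon>) \<le> v" if "v \<in> energy_values ?\<mu> \<epsilon>" for v
    using that unfolding energy_values_def by (elim CollectE exE conjE) (simp only: lower)
  then have Inf: "Inf (energy_values ?\<mu> \<epsilon>) = t\<^sup>2 / (t + \<epsilon>)"
    by (rule cInf_eq_minimum[OF attained])
  show ?thesis
    unfolding assms(9) here(2) Inf by (intro conjI allI impI here(1) attained refl lower)
qed

end
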